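(* For every $\alpha\in\mathbb{C}$ and every integer $n\ge 1$, $$H_n(\alpha)=H_n+\sum_{k=1}^n\binom{n}{k}\frac{(\alpha-1)^k}{k}.$$
   Context: For $\alpha\in\mathbb{C}$ and an integer $n\ge1$, the generalized harmonic number is $H_n(\alpha)=\sum_{j=1}^n\frac{\alpha^j}{j}$, and $H_n=H_n(1)=\sum_{j=1}^n\frac1j$ is the harmonic number. *)

theory Defs
  imports "HOL-Analysis.Analysis"
begin

definition gen_harm :: "nat \<Rightarrow> complex \<Rightarrow> complex" where
  "gen_harm n \<alpha> = (\<Sum>j=1..n. \<alpha> ^ j / of_nat j)"

lemma gen_harm_1: "gen_harm n 1 = harm n"
  by (simp add: gen_harm_def harm_def inverse_eq_divide)

end

theory Submission
  imports Defs
begin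

text \<open>Induction on n: it suffices that both sides grow equally from n to n+1. By Pascal's rule
  the coefficient C(n+1,k)/k exceeds C(n,k)/k by C(n,k-1)/k, which absorption turns into
  C(n+1,k)/(n+1). This denominator is free of k, so the binomial theorem sums the increments;
  \<open>sum_choose_power_div_Suc\<close> records the result. At x = \<alpha> - 1 the total is
  (\<alpha>^(n+1) - 1)/(n+1), and adding the harmonic increment 1/(n+1) leaves exactly the new term
  of \<open>gen_harm\<close>.\<close>

lemma sum_choose_power_div_Suc:
  fixes x :: "'a::field_char_0"
  shows "(\<Sum>k=1..Suc n. of_nat (Suc n choose k) * (x ^ k / of_nat k)) =
    (\<Sum>k=1..n. of_nat (n choose k) * (x ^ k / of_nat k)) + ((x + 1) ^ Suc n - 1) / of_nat (Suc n)"
proof -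
  have pascal: "of_nat (Suc n choose k) * (x ^ k / of_nat k) =
      of_nat (n choose k) * (x ^ k / of_nat k) + of_nat (Suc n choose k) * x ^ k / of_nat (Suc n)"
    if k_range: "k \<in> {1..Suc n}" for k
  proof -
    obtain j where k: "k = Suc j"
      using k_range by (cases k) auto
    \<comment> \<open>Absorption identity: it trades the varying denominator k = j+1 for the
      constant n+1.\<close>
    have absorb: "of_nat (Suc n) * of_nat (n choose j) = (of_nat (Suc j) * of_nat (Suc n choose Suc j) :: 'a)"
      by (metis Suc_times_binomial_eq mult.commute of_nat_mult)
    have "of_nat (n choose j) / of_nat (Suc j) = (of_nat (Suc n choose Suc j) / of_nat (Suc n) :: 'a)"
      using absorb by (simp add: frac_eq_eq mult.commute del: of_nat_Suc binomial_Suc_Suc)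
    then have "x ^ k * (of_nat (n choose j) / of_nat k) = x ^ k * (of_nat (Suc n choose k) / of_nat (Suc n))"
      unfolding k by (rule arg_cong)
    moreover have "of_nat (Suc n choose k) = (of_nat (n choose k) + of_nat (n choose j) :: 'a)"
      by (simp add: k)
    ultimately show ?thesis
      by (simp add: distrib_left add_divide_distrib mult.commute del: of_nat_Suc)
  qed
  have "(x + 1) ^ Suc n = (\<Sum>k=0..Suc n. of_nat (Suc n choose k) * x ^ k)"
    by (simp add: binomial_ring atLeast0AtMost del: power_Suc)
  \<comment> \<open>Splitting off the k = 0 term, absent from the sum in the lemma, produces the
    -1.\<close>
  also have "\<dots> = 1 + (\<Sum>k=1..Suc n. of_nat (Suc n choose k) * x ^ k)"
    by (subst sum.atLeast_Suc_atMost) auto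
  finally have "(\<Sum>k=1..Suc n. of_nat (Suc n choose k) * x ^ k) = (x + 1) ^ Suc n - 1"
    by simp
  then have "(\<Sum>k=1..Suc n. of_nat (Suc n choose k) * x ^ k / of_nat (Suc n)) =
      ((x + 1) ^ Suc n - 1) / of_nat (Suc n)"
    by (simp only: sum_divide_distrib [symmetric])
  \<comment> \<open>The top term k = n+1 vanishes, since n choose n+1 is 0.\<close>
  moreover have "(\<Sum>k=1..Suc n. of_nat (n choose k) * (x ^ k / of_nat k)) =
      (\<Sum>k=1..n. of_nat (n choose k) * (x ^ k / of_nat k))"
    by simp
  ultimately show ?thesis
    by (simp only: sum.cong [OF refl pascal] sum.distrib)
qed

theorem mainTheorem3:
  fixes \<alpha> :: complex and n :: nat
  assumes "n \<ge> 1"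
  shows "gen_harm n \<alpha> =
    harm n + (\<Sum>k=1..n. of_nat (n choose k) * ((\<alpha> - 1) ^ k / of_nat k))"
proof (induction n)
  case 0
  show ?case
    by (simp add: gen_harm_def harm_def)
next
  case (Suc n)
  have "gen_harm (Suc n) \<alpha> = gen_harm n \<alpha> + \<alpha> ^ Suc n / of_nat (Suc n)"
    by (simp add: gen_harm_def)
  \<comment> \<open>With x = \<alpha> - 1 the base x + 1 collapses to \<alpha>, and the -1/(n+1)
    cancels the new harmonic term.\<close>
  then show ?case
    unfolding sum_choose_power_div_Suc Suc.IH harm_Suc
    by (simp add: diff_divide_distrib inverse_eq_divide del: of_nat_Suc power_Suc)
qed

end
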